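(* Let $n,m\ge1$, let $u\in\mathbb{R}^n$, let $K\in\mathbb{R}^{n\times n}$ be symmetric positive definite, let $A\in\mathbb{R}^{m\times n}$ and $b\in\mathbb{R}^m$. Let $\mathbf{g}$ be the $\mathbb{R}^n$-valued random vector whose density is proportional to $\phi(\mathbf{g}\mid u,K)\,\Phi(A\mathbf{g}+b\mid 0,I_m)$ (the finite-dimensional distribution of a constrained Gaussian process with constraint $\mathcal{C}=\{\mathbf{g}:A\mathbf{g}+b\ge0\}$). Then the probability density function of $\mathbf{g}$ is $$f(\mathbf{g}\mid u,K,\mathcal{C})=\frac{\phi(\mathbf{g}\mid u,K)\,\Phi(A\mathbf{g}+b\mid 0,I_m)}{\Phi(Au+b\mid 0,\,I_m+AKA^\top)},$$ and its moment generating function is, for all $t\in\mathbb{R}^n$, $$M_{\mathbf{g}}(t)=E[e^{t^\top\mathbf{g}}]=\exp\!\Big(u^\top t+\tfrac12 t^\top Kt\Big)\,\frac{\Phi(Au+b+AKt\mid 0,\,I_m+AKA^\top)}{\Phi(Au+b\mid 0,\,I_m+AKA^\top)}.$$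
   Context: $\phi(\cdot\mid\mu,\Sigma)$ and $\Phi(\cdot\mid\mu,\Sigma)$ denote the probability density function and the cumulative distribution function of the multivariate Gaussian distribution with mean $\mu$ and covariance $\Sigma$; thus $\Phi(c\mid\mu,\Sigma)=P(X\le c\text{ componentwise})$ for $X\sim N(\mu,\Sigma)$. A constrained Gaussian process $CGP(\mu,k,\mathcal{C})$ evaluated at $n$ inputs $\mathbf{z}$ is the random vector $\mathbf{g}=g(\mathbf{z})$ with density proportional to $\phi(\mathbf{g}\mid u,K)\,\Phi(A\mathbf{g}+b\mid 0,I_m)$, where $u$ and $K$ are the mean vector and kernel matrix of the Gaussian process $GP(\mu,k)$ at $\mathbf{z}$. *)

theory Defs
  imports "HOL-Probability.Probability"
begin

definition sym_pos_def :: "real ^ 'n ^ 'n \<Rightarrow> bool" where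
  "sym_pos_def S \<longleftrightarrow> transpose S = S \<and> (\<forall>x. x \<noteq> 0 \<longrightarrow> x \<bullet> (S *v x) > 0)"

text \<open>
  The Gaussian density and distribution are meaningful only for a symmetric positive definite
  covariance matrix; for other matrices the formulas below carry no probabilistic meaning.
\<close>

definition mvn_density :: "real ^ 'n \<Rightarrow> real ^ 'n ^ 'n \<Rightarrow> real ^ 'n \<Rightarrow> real" where
  "mvn_density \<mu> S x =
     exp (- ((x - \<mu>) \<bullet> (matrix_inv S *v (x - \<mu>))) / 2) / sqrt ((2 * pi) ^ CARD('n) * det S)"

definition mvn :: "real ^ 'n \<Rightarrow> real ^ 'n ^ 'n \<Rightarrow> (real ^ 'n) measure" where
  "mvn \<mu> S = density lborel (\<lambda>x. ennreal (mvn_density \<mu> S x))"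

definition mvn_cdf :: "real ^ 'n \<Rightarrow> real ^ 'n ^ 'n \<Rightarrow> real ^ 'n \<Rightarrow> real" where
  "mvn_cdf \<mu> S c = measure (mvn \<mu> S) {x. \<forall>i. x $ i \<le> c $ i}"

text \<open>
  \<open>cgp_vector M g u K A b\<close>: the random vector \<open>g\<close> on \<open>M\<close> is the evaluation of a Gaussian process,
  with mean vector \<open>u\<close> and kernel matrix \<open>K\<close> at the inputs, constrained by \<open>A g + b \<ge> 0\<close>. The
  normalising constant is left unspecified.
\<close>

definition cgp_vector ::
  "'a measure \<Rightarrow> ('a \<Rightarrow> real ^ 'n) \<Rightarrow> real ^ 'n \<Rightarrow> real ^ 'n ^ 'n \<Rightarrow> real ^ 'n ^ 'm \<Rightarrow> real ^ 'm \<Rightarrow> bool"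
where
  "cgp_vector M g u K A b \<longleftrightarrow>
     (\<exists>c>0. distributed M lborel g
        (\<lambda>x. ennreal (c * (mvn_density u K x * mvn_cdf 0 (mat 1) (A *v x + b)))))"

definition mgf :: "'a measure \<Rightarrow> ('a \<Rightarrow> real ^ 'n) \<Rightarrow> real ^ 'n \<Rightarrow> real" where
  "mgf M X t = prob_space.expectation M (\<lambda>\<omega>. exp (t \<bullet> X \<omega>))"

end

theory Submission
  imports Defs
begin

text \<open>
  Write \<open>\<Phi> (A x + b)\<close> as the integral of the \<open>N(0, I)\<close> density over \<open>y \<le> A x + b\<close> and substitute
  \<open>y = A (x - u) + w\<close>: the region becomes \<open>w \<le> A u + b\<close>, and integrating out \<open>x\<close> first leaves the
  \<open>N(0, I + A K A\<^sup>T)\<close> density in \<open>w\<close>. This gives the normalising constant. For the moment generating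
  function, \<open>exp (t\<^sup>T x) \<phi>(x | u, K)\<close> is a constant multiple of \<open>\<phi>(x | u + K t, K)\<close>, so the same
  integral is evaluated with \<open>u + K t\<close> in place of \<open>u\<close>.
\<close>

section \<open>Linear change of variables for Lebesgue measure\<close>

text \<open>
  The change of variables theorems of \<^theory>\<open>HOL-Analysis.Change_Of_Vars\<close> need a well-ordered index
  type, whereas the index types here are only finite.
\<close>

lemma bij_betw_axis_Basis: "bij_betw (\<lambda>i. axis i 1 :: real ^ 'n) UNIV Basis"
  by (auto simp: bij_betw_def inj_on_def axis_eq_axis Basis_vec_def)

lemma prod_Basis_cart: "(\<Prod>b\<in>Basis. f (b :: real ^ 'n)) = (\<Prod>i\<in>UNIV. f (axis i 1))"
  by (rule prod.reindex_bij_betw[OF bij_betw_axis_Basis, symmetric])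

lemma sum_Basis_cart: "(\<Sum>b\<in>Basis. f (b :: real ^ 'n)) = (\<Sum>i\<in>UNIV. f (axis i 1))"
  by (rule sum.reindex_bij_betw[OF bij_betw_axis_Basis, symmetric])

lemma nn_integral_lborel_translate:
  fixes f :: "'a::euclidean_space \<Rightarrow> ennreal"
  assumes [measurable]: "f \<in> borel_measurable borel"
  shows "(\<integral>\<^sup>+x. f (c + x) \<partial>lborel) = (\<integral>\<^sup>+x. f x \<partial>lborel)"
proof -
  have "(\<integral>\<^sup>+x. f x \<partial>lborel) = (\<integral>\<^sup>+x. f x \<partial>distr lborel borel ((+) c))"
    by (simp add: lborel_distr_plus)
  also have "\<dots> = (\<integral>\<^sup>+x. f (c + x) \<partial>lborel)"
    by (subst nn_integral_distr) auto
  finally show ?thesis by simp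
qed

lemma borel_measurable_vec_nth [measurable (raw)]:
  "f \<in> M \<rightarrow>\<^sub>M borel \<Longrightarrow> (\<lambda>x. (f x :: real ^ 'n) $ i) \<in> M \<rightarrow>\<^sub>M borel"
  by (rule borel_measurable_continuous_on) (intro continuous_intros)

lemma borel_measurable_matrix_vector_mult [measurable (raw)]:
  fixes A :: "real ^ 'n ^ 'm"
  assumes "f \<in> M \<rightarrow>\<^sub>M borel"
  shows "(\<lambda>x. A *v f x) \<in> M \<rightarrow>\<^sub>M borel"
  by (intro borel_measurable_continuous_on[OF _ assms] linear_continuous_on
      matrix_vector_mul_bounded_linear)

text \<open>In coordinates a diagonal matrix scales each basis vector separately, which is the form
  of \<open>lborel_affine_euclidean\<close>. The scale factors \<open>c j\<close> are the diagonal
  entries, and their product is the determinant.\<close>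

lemma nn_integral_lborel_diagonal:
  fixes A :: "real ^ 'n ^ 'n" and f :: "real ^ 'n \<Rightarrow> ennreal"
  assumes diag: "\<And>i j. i \<noteq> j \<Longrightarrow> A $ i $ j = 0" and "det A \<noteq> 0"
    and f [measurable]: "f \<in> borel_measurable borel"
  shows "\<bar>det A\<bar> * (\<integral>\<^sup>+x. f (A *v x) \<partial>lborel) = (\<integral>\<^sup>+x. f x \<partial>lborel)"
proof -
  have det: "det A = (\<Prod>i\<in>UNIV. A $ i $ i)"
    using diag by (rule det_diagonal)
  define c where "c j = (A *v j) \<bullet> j" for j :: "real ^ 'n"
  have c: "c (axis i 1) = A $ i $ i" for i
    by (simp add: c_def matrix_vector_mult_basis inner_axis column_def)
  have c0: "c j \<noteq> 0" if "j \<in> Basis" for j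
    using that assms(2) c by (auto simp: Basis_vec_def det)
  have A: "(\<Sum>j\<in>Basis. (c j * (x \<bullet> j)) *\<^sub>R j) = A *v x" for x
  proof -
    have "(A *v x) $ i = A $ i $ i * x $ i" for i
      unfolding matrix_vector_mult_def vec_lambda_beta
      by (subst sum.remove[of _ i]) (auto intro!: sum.neutral simp: diag)
    then show ?thesis
      by (simp add: sum_Basis_cart c vec_eq_iff inner_axis) (simp add: axis_def if_distrib cong: if_cong)
  qed
  have "(lborel :: (real ^ 'n) measure) = density (distr lborel borel ((*v) A)) (\<lambda>_. \<bar>det A\<bar>)"
    using lborel_affine_euclidean[of c 0, OF c0]
    by (simp add: A det c prod_Basis_cart abs_prod)
  then have "(\<integral>\<^sup>+x. f x \<partial>lborel) = (\<integral>\<^sup>+x. f x \<partial>density (distr lborel borel ((*v) A)) (\<lambda>_. \<bar>det A\<bar>))"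
    by simp
  also have "\<dots> = \<bar>det A\<bar> * (\<integral>\<^sup>+x. f (A *v x) \<partial>lborel)"
    by (simp add: nn_integral_density nn_integral_cmult nn_integral_distr)
  finally show ?thesis ..
qed

text \<open>Lebesgue measure is determined by its values on boxes. The preimage of a box is the box
  with side lengths permuted, so its volume is the same.\<close>

lemma lborel_distr_permute:
  fixes p :: "'n \<Rightarrow> 'n::finite"
  assumes "bij p"
  shows "distr lborel borel (\<lambda>x::real ^ 'n. \<chi> i. x $ p i) = lborel"
proof (rule lborel_eqI[symmetric])
  have m: "(\<lambda>x::real ^ 'n. \<chi> i. x $ p i) \<in> borel_measurable borel"
    by (intro borel_measurable_continuous_onI continuous_intros)
  fix l u :: "real ^ 'n"
  assume le: "\<And>b. b \<in> Basis \<Longrightarrow> l \<bullet> b \<le> u \<bullet> b"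
  let ?q = "\<lambda>x::real ^ 'n. \<chi> i. x $ inv p i"
  have *: "(\<forall>i. P (p i) i) \<longleftrightarrow> (\<forall>i. P i (inv p i))" for P
    using assms by (metis bij_inv_eq_iff)
  have "(\<lambda>x::real ^ 'n. \<chi> i. x $ p i) -` box l u = box (?q l) (?q u)"
    using *[of "\<lambda>i j. l $ j < _ $ i \<and> _ $ i < u $ j"] by (auto simp: mem_box_cart)
  moreover have "?q l \<bullet> b \<le> ?q u \<bullet> b" if "b \<in> Basis" for b
    using that le[of "axis _ 1"] by (fastforce simp: Basis_vec_def inner_axis)
  moreover have "(\<Prod>i\<in>UNIV. u $ inv p i - l $ inv p i) = (\<Prod>i\<in>UNIV. u $ i - l $ i)"
    using assms by (intro prod.reindex_bij_betw bij_imp_bij_inv)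
  ultimately show "emeasure (distr lborel borel (\<lambda>x. \<chi> i. x $ p i)) (box l u) = (\<Prod>b\<in>Basis. (u - l) \<bullet> b)"
    using m by (simp add: emeasure_distr emeasure_lborel_box prod_Basis_cart inner_axis)
qed simp

text \<open>
  Translation invariance gives \<open>\<integral>f (x + c x\<^sub>n e\<^sub>m) dx = \<integral>f (x + (s + c x\<^sub>n) e\<^sub>m) dx\<close> for all \<open>s\<close>.
  Averaging over \<open>s \<in> [0, 1]\<close> and translating first \<open>s\<close>, then \<open>x\<close>, removes the shear.
\<close>

lemma nn_integral_lborel_shear:
  fixes f :: "real ^ 'n \<Rightarrow> ennreal"
  assumes "m \<noteq> n" and f [measurable]: "f \<in> borel_measurable borel"
  shows "(\<integral>\<^sup>+x. f (x + (c * x $ n) *\<^sub>R axis m 1) \<partial>lborel) = (\<integral>\<^sup>+x. f x \<partial>lborel)"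
proof -
  define e :: "real ^ 'n" where "e = axis m 1"
  \<comment> \<open>This is where \<open>m \<noteq> n\<close> enters: translating along
    \<open>e\<close> leaves the coordinate \<open>x $ n\<close>, and hence the shear coefficient,
    unchanged.\<close>
  have e: "e $ n = 0" using assms(1) by (simp add: e_def axis_def)
  define w :: "real \<Rightarrow> ennreal" where "w = indicator {0..1}"
  have [measurable]: "w \<in> borel_measurable borel" by (simp add: w_def)
  have w1: "(\<integral>\<^sup>+s. w s \<partial>lborel) = 1" by (simp add: w_def)
  define J where "J = (\<integral>\<^sup>+x. f (x + (c * x $ n) *\<^sub>R e) \<partial>lborel)"
  have "J = (\<integral>\<^sup>+s. w s * J \<partial>lborel)"
    by (simp add: nn_integral_multc w1)
  also have "\<dots> = (\<integral>\<^sup>+s. \<integral>\<^sup>+x. w s * f (x + (s + c * x $ n) *\<^sub>R e) \<partial>lborel \<partial>lborel)"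
  proof (rule nn_integral_cong)
    fix s
    have "J = (\<integral>\<^sup>+x. f ((s *\<^sub>R e + x) + (c * (s *\<^sub>R e + x) $ n) *\<^sub>R e) \<partial>lborel)"
      unfolding J_def by (rule nn_integral_lborel_translate[symmetric]) measurable
    then show "w s * J = (\<integral>\<^sup>+x. w s * f (x + (s + c * x $ n) *\<^sub>R e) \<partial>lborel)"
      by (simp add: nn_integral_cmult e algebra_simps)
  qed
  also have "\<dots> = (\<integral>\<^sup>+x. \<integral>\<^sup>+s. w s * f (x + (s + c * x $ n) *\<^sub>R e) \<partial>lborel \<partial>lborel)"
    by (rule lborel_pair.Fubini') measurable
  also have "\<dots> = (\<integral>\<^sup>+x. \<integral>\<^sup>+s. w (s - c * x $ n) * f (x + s *\<^sub>R e) \<partial>lborel \<partial>lborel)"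
  proof (rule nn_integral_cong)
    fix x :: "real ^ 'n"
    show "(\<integral>\<^sup>+s. w s * f (x + (s + c * x $ n) *\<^sub>R e) \<partial>lborel) = (\<integral>\<^sup>+s. w (s - c * x $ n) * f (x + s *\<^sub>R e) \<partial>lborel)"
      using nn_integral_lborel_translate[of "\<lambda>s. w (s - c * x $ n) * f (x + s *\<^sub>R e)" "c * x $ n"]
      by (simp add: algebra_simps)
  qed
  also have "\<dots> = (\<integral>\<^sup>+s. \<integral>\<^sup>+x. w (s - c * x $ n) * f (x + s *\<^sub>R e) \<partial>lborel \<partial>lborel)"
    by (rule lborel_pair.Fubini') measurable
  also have "\<dots> = (\<integral>\<^sup>+s. \<integral>\<^sup>+x. w (s - c * x $ n) * f x \<partial>lborel \<partial>lborel)"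
  proof (rule nn_integral_cong)
    fix s :: real
    show "(\<integral>\<^sup>+x. w (s - c * x $ n) * f (x + s *\<^sub>R e) \<partial>lborel) = (\<integral>\<^sup>+x. w (s - c * x $ n) * f x \<partial>lborel)"
      using nn_integral_lborel_translate[of "\<lambda>x. w (s - c * x $ n) * f x" "s *\<^sub>R e"]
      by (simp add: e add.commute)
  qed
  also have "\<dots> = (\<integral>\<^sup>+x. \<integral>\<^sup>+s. w (s - c * x $ n) * f x \<partial>lborel \<partial>lborel)"
    by (rule lborel_pair.Fubini') measurable
  also have "\<dots> = (\<integral>\<^sup>+x. f x \<partial>lborel)"
  proof (rule nn_integral_cong)
    fix x :: "real ^ 'n"
    have "(\<integral>\<^sup>+s. w (s - c * x $ n) \<partial>lborel) = 1"
      using nn_integral_lborel_translate[of w "- (c * x $ n)"] w1 by (simp add: algebra_simps)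
    then show "(\<integral>\<^sup>+s. w (s - c * x $ n) * f x \<partial>lborel) = f x"
      by (simp add: nn_integral_multc)
  qed
  finally show ?thesis by (simp add: J_def e_def)
qed

text \<open>The formula is multiplicative in \<open>A\<close>, so induction over elementary matrices
  reduces it to diagonal matrices, coordinate swaps and shears.\<close>

lemma nn_integral_lborel_linear:
  fixes A :: "real ^ 'n ^ 'n" and f :: "real ^ 'n \<Rightarrow> ennreal"
  assumes "det A \<noteq> 0" "f \<in> borel_measurable borel"
  shows "\<bar>det A\<bar> * (\<integral>\<^sup>+x. f (A *v x) \<partial>lborel) = (\<integral>\<^sup>+x. f x \<partial>lborel)"
proof -
  \<comment> \<open>The implication makes the zero-row case vacuous. The quantifier over
    \<open>f\<close> is kept inside because the product case applies the hypothesis for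
    \<open>B\<close> to the composition of \<open>f\<close> with \<open>A\<close>.\<close>
  let ?P = "\<lambda>A::real ^ 'n ^ 'n. det A \<noteq> 0 \<longrightarrow> (\<forall>f\<in>borel_measurable borel.
    \<bar>det A\<bar> * (\<integral>\<^sup>+x. f (A *v x) \<partial>lborel) = (\<integral>\<^sup>+x. f x \<partial>lborel))"
  have "?P A"
  proof (induction A rule: induct_matrix_elementary)
    case (1 A B)
    show ?case
    proof (intro impI ballI)
      fix f :: "real ^ 'n \<Rightarrow> ennreal"
      assume nz: "det (A ** B) \<noteq> 0" and [measurable]: "f \<in> borel_measurable borel"
      have A: "\<bar>det A\<bar> * (\<integral>\<^sup>+x. f (A *v x) \<partial>lborel) = (\<integral>\<^sup>+x. f x \<partial>lborel)"
        using 1 nz by (auto simp: det_mul)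
      have B: "\<bar>det B\<bar> * (\<integral>\<^sup>+x. f (A *v (B *v x)) \<partial>lborel) = (\<integral>\<^sup>+x. f (A *v x) \<partial>lborel)"
        by (rule 1(2)[rule_format, of "\<lambda>x. f (A *v x)"]) (use nz in \<open>auto simp: det_mul\<close>)
      show "\<bar>det (A ** B)\<bar> * (\<integral>\<^sup>+x. f (A ** B *v x) \<partial>lborel) = (\<integral>\<^sup>+x. f x \<partial>lborel)"
        by (simp add: A[symmetric] B[symmetric] det_mul abs_mult ennreal_mult mult.assoc
            flip: matrix_vector_mul_assoc)
    qed
  next
    case (2 A i)
    then show ?case by (simp add: det_zero_row)
  next
    case (3 A)
    then show ?case using nn_integral_lborel_diagonal by blast
  next
    case (4 m n)
    let ?t = "Transposition.transpose m n" and ?A = "(\<chi> i j. mat 1 $ i $ Transposition.transpose m n j) :: real ^ 'n ^ 'n"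
    have bij: "bij ?t" by simp
    have "\<bar>det ?A\<bar> = 1"
      using 4 by (simp add: det_permute_columns permutes_swap_id sign_swap_id abs_mult)
    moreover have "?A *v x = (\<chi> i. x $ ?t i)" for x :: "real ^ 'n"
    proof -
      have eq: "(i = ?t j) \<longleftrightarrow> (?t i = j)" for i j by (metis transpose_involutory)
      show ?thesis
        by (simp add: vec_eq_iff matrix_vector_mult_def mat_def if_distrib[of "\<lambda>a. a * _"] eq cong: if_cong)
    qed
    moreover have "(\<integral>\<^sup>+x. f (\<chi> i. x $ ?t i) \<partial>lborel) = (\<integral>\<^sup>+x. f x \<partial>lborel)"
      if [measurable]: "f \<in> borel_measurable borel" for f :: "real ^ 'n \<Rightarrow> ennreal"
    proof -
      have "(\<lambda>x::real ^ 'n. \<chi> i. x $ ?t i) \<in> borel_measurable borel"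
        by (intro borel_measurable_continuous_onI continuous_intros)
      then show ?thesis
        by (subst (2) lborel_distr_permute[OF bij, symmetric]) (simp add: nn_integral_distr)
    qed
    ultimately show ?case by simp
  next
    case (5 m n c)
    let ?A = "(\<chi> i j. if i = m \<and> j = n then c else of_bool (i = j)) :: real ^ 'n ^ 'n"
    have A: "?A *v x = x + (c * x $ n) *\<^sub>R axis m 1" for x
    proof -
      have "(?A *v x) $ i = (x + (c * x $ n) *\<^sub>R axis m 1) $ i" for i
      proof -
        have "(?A *v x) $ i = (\<Sum>j\<in>UNIV. (if j = i then x $ i else 0) + (if j = n then (if i = m then c * x $ n else 0) else 0))"
          unfolding matrix_vector_mult_def vec_lambda_beta using 5 by (intro sum.cong) auto
        then show ?thesis by (simp add: sum.distrib axis_def)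
      qed
      then show ?thesis by (simp add: vec_eq_iff)
    qed
    have "det ?A = 1"
    proof -
      have "?A = (\<chi> k. if k = m then row m (mat 1) + c *s row n (mat 1) else row k (mat 1))"
        using 5 by (auto simp: vec_eq_iff row_def mat_def)
      then show ?thesis
        using det_row_operation[OF 5, of "mat 1" c] by simp
    qed
    then show ?case
      using nn_integral_lborel_shear[OF 5] by (simp add: A)
  qed
  with assms show ?thesis by blast
qed

section \<open>Gaussian densities\<close>

lemma sym_pos_def_inner:
  assumes "sym_pos_def S"
  shows "x \<bullet> (S *v y) = (S *v x) \<bullet> y"
  using assms by (metis dot_lmul_matrix sym_pos_def_def transpose_matrix_vector)

text \<open>Gram-Schmidt for the inner product \<open>x \<bullet> (S *v y)\<close>: while
  \<open>k\<close> is below the dimension, some \<open>v\<close> lies outside the span; subtracting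
  its projection \<open>p\<close> and normalising gives the next vector.\<close>

lemma sym_pos_def_orthonormal_set:
  fixes S :: "real ^ 'n ^ 'n"
  assumes S: "sym_pos_def S" and "k \<le> CARD('n)"
  shows "\<exists>B. finite B \<and> card B = k \<and> (\<forall>x\<in>B. \<forall>y\<in>B. x \<bullet> (S *v y) = of_bool (x = y))"
  using assms(2)
proof (induction k)
  case 0
  show ?case by (intro exI[of _ "{}"]) simp
next
  case (Suc k)
  then obtain B where B: "finite B" "card B = k"
    and ortho: "\<And>x y. x \<in> B \<Longrightarrow> y \<in> B \<Longrightarrow> x \<bullet> (S *v y) = of_bool (x = y)"
    by auto
  have "dim B < DIM(real ^ 'n)"
    using dim_le_card'[OF B(1)] B Suc.prems by simp
  then have "span B \<noteq> UNIV"
    using dim_UNIV[where 'a = "real ^ 'n"] dim_span[of B] by force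
  then obtain v where v: "v \<notin> span B" by blast
  define p where "p = (\<Sum>b\<in>B. (b \<bullet> (S *v v)) *\<^sub>R b)"
  have "p \<in> span B"
    unfolding p_def by (intro span_sum span_scale span_base)
  with v have "v - p \<noteq> 0" by auto
  define r where "r = (v - p) \<bullet> (S *v (v - p))"
  have r: "r > 0"
    using S \<open>v - p \<noteq> 0\<close> by (auto simp: sym_pos_def_def r_def)
  have orth: "a \<bullet> (S *v (v - p)) = 0" if "a \<in> B" for a
  proof -
    have "a \<bullet> (S *v p) = (\<Sum>b\<in>B. (b \<bullet> (S *v v)) * (a \<bullet> (S *v b)))"
      by (simp add: sym_pos_def_inner[OF S, of a] p_def inner_sum_right)
    also have "\<dots> = (\<Sum>b\<in>B. if b = a then a \<bullet> (S *v v) else 0)"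
      using ortho that by (intro sum.cong) auto
    also have "\<dots> = a \<bullet> (S *v v)" using B that by simp
    finally show ?thesis by (simp add: matrix_vector_mult_diff_distrib inner_diff_right)
  qed
  define w where "w = (1 / sqrt r) *\<^sub>R (v - p)"
  have Sw: "S *v w = (1 / sqrt r) *\<^sub>R (S *v (v - p))"
    by (simp add: w_def matrix_vector_mult_scaleR)
  have aw: "a \<bullet> (S *v w) = 0" if "a \<in> B" for a
    using orth[OF that] by (simp add: Sw)
  have wa: "w \<bullet> (S *v a) = 0" if "a \<in> B" for a
    using aw[OF that] sym_pos_def_inner[OF S, of w a] by (simp add: inner_commute)
  have ww: "w \<bullet> (S *v w) = 1"
    using r by (simp add: Sw) (simp add: w_def r_def[symmetric] real_div_sqrt)
  have "w \<notin> B" using aw ww by fastforce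
  then show ?case
    using B ortho aw wa ww by (intro exI[of _ "insert w B"]) auto
qed

lemma matrix_inv_eqI:
  fixes S :: "real ^ 'n ^ 'n"
  assumes "B ** S = mat 1"
  shows "matrix_inv S = B"
proof -
  have "S ** B = mat 1" using assms by (simp add: matrix_left_right_inverse)
  then have "S ** matrix_inv S = mat 1"
    \<comment> \<open>\<open>matrix_inv\<close> is a choice among two-sided inverses;
      \<open>B\<close> witnesses that one exists.\<close>
    unfolding matrix_inv_def using assms by (rule_tac someI2[of _ B]) auto
  then show ?thesis
    by (metis assms matrix_mul_assoc matrix_mul_lid matrix_mul_rid)
qed

text \<open>The rows of \<open>Q\<close> are an \<open>S\<close>-orthonormal basis, so
  \<open>Q\<close> is a whitening matrix: \<open>Q ** S ** transpose Q\<close> is the identity. It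
  turns the quadratic form of \<open>matrix_inv S\<close> into a squared Euclidean norm.\<close>

lemma sym_pos_def_factor:
  fixes S :: "real ^ 'n ^ 'n"
  assumes S: "sym_pos_def S"
  obtains Q :: "real ^ 'n ^ 'n" where "det Q \<noteq> 0" "det S = 1 / (det Q)\<^sup>2"
    "transpose Q ** Q ** S = mat 1" "matrix_inv S = transpose Q ** Q"
proof -
  obtain B where B: "finite B" "card B = CARD('n)"
    and ortho: "\<And>x y. x \<in> B \<Longrightarrow> y \<in> B \<Longrightarrow> x \<bullet> (S *v y) = of_bool (x = y)"
    using sym_pos_def_orthonormal_set[OF S order_refl] by auto
  then obtain f :: "'n \<Rightarrow> real ^ 'n" where f: "bij_betw f UNIV B"
    using finite_same_card_bij[of "UNIV :: 'n set" B] by auto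
  define Q where "Q = (\<chi> i. f i)"
  have "(Q ** S ** transpose Q) $ i $ j = mat 1 $ i $ j" for i j
  proof -
    have "(Q ** S ** transpose Q) $ i $ j = f i \<bullet> (S *v f j)"
      by (simp add: Q_def matrix_mul_assoc[symmetric])
         (simp add: matrix_matrix_mult_def matrix_vector_mult_def inner_vec_def transpose_def)
    also have "\<dots> = of_bool (f i = f j)"
      using f ortho by (auto simp: bij_betw_def)
    also have "f i = f j \<longleftrightarrow> i = j"
      using f by (auto simp: bij_betw_def inj_on_def)
    finally show ?thesis by (simp add: mat_def)
  qed
  then have Q: "Q ** S ** transpose Q = mat 1" by (simp add: vec_eq_iff)
  \<comment> \<open>One-sided inverses of square matrices are two-sided, so the outer factor
    \<open>Q\<close> can be moved cyclically to the other end.\<close>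
  then have inv: "transpose Q ** Q ** S = mat 1"
    by (metis matrix_left_right_inverse matrix_mul_assoc)
  have det: "(det Q)\<^sup>2 * det S = 1"
    using arg_cong[OF inv, of det] by (simp add: det_mul power2_eq_square)
  then have "det Q \<noteq> 0" by auto
  moreover have "det S = 1 / (det Q)\<^sup>2" using det calculation by (simp add: field_simps)
  ultimately show thesis using that inv matrix_inv_eqI[OF inv] by blast
qed

lemma sym_pos_def_det_pos: "sym_pos_def S \<Longrightarrow> det S > 0"
  by (metis sym_pos_def_factor zero_less_divide_1_iff zero_less_power2)

lemma sym_pos_def_matrix_inv:
  assumes "sym_pos_def S"
  shows "matrix_inv S *v (S *v x) = x" "S *v (matrix_inv S *v x) = x"
proof -
  have inv: "matrix_inv S ** S = mat 1"
    using sym_pos_def_factor[OF assms] by metis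
  then have "S ** matrix_inv S = mat 1" by (simp add: matrix_left_right_inverse)
  with inv show "matrix_inv S *v (S *v x) = x" "S *v (matrix_inv S *v x) = x"
    by (simp_all add: matrix_vector_mul_assoc)
qed

lemma sym_pos_def_matrix_inv_inner:
  assumes "sym_pos_def S"
  shows "x \<bullet> (matrix_inv S *v y) = (matrix_inv S *v x) \<bullet> y"
  by (metis assms sym_pos_def_inner sym_pos_def_matrix_inv(2))

section \<open>Total mass of the Gaussian density\<close>

lemma mvn_density_nonneg: "sym_pos_def S \<Longrightarrow> mvn_density \<mu> S x \<ge> 0"
  using sym_pos_def_det_pos[of S] by (simp add: mvn_density_def)

lemma borel_measurable_mvn_density [measurable]: "mvn_density \<mu> S \<in> borel_measurable borel"
  unfolding mvn_density_def by measurable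

text \<open>The integrand is a product of one-dimensional standard normal densities, one per
  coordinate, each of integral 1.\<close>

lemma nn_integral_exp_norm:
  "(\<integral>\<^sup>+x. ennreal (exp (- ((x :: real ^ 'n) \<bullet> x) / 2) / sqrt ((2 * pi) ^ CARD('n))) \<partial>lborel) = 1"
proof -
  have *: "exp (- (x \<bullet> x) / 2) / sqrt ((2 * pi) ^ CARD('n)) = (\<Prod>b\<in>Basis. std_normal_density (x \<bullet> b))"
    for x :: "real ^ 'n"
  proof -
    have "x \<bullet> x = (\<Sum>b\<in>Basis. (x \<bullet> b)\<^sup>2)"
      by (subst euclidean_inner) (simp add: power2_eq_square)
    then have "exp (- (x \<bullet> x) / 2) = (\<Prod>b\<in>Basis. exp (- (x \<bullet> b)\<^sup>2 / 2))"
      by (simp add: exp_sum[symmetric] sum_negf sum_divide_distrib)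
    moreover have "sqrt ((2 * pi) ^ CARD('n)) = (\<Prod>b\<in>(Basis :: (real ^ 'n) set). sqrt (2 * pi))"
      unfolding real_sqrt_power by simp
    ultimately show ?thesis
      by (simp add: std_normal_density_def prod_dividef[symmetric] prod.distrib[symmetric] del: prod_constant)
  qed
  have "(\<integral>\<^sup>+s. ennreal (std_normal_density s) \<partial>lborel) = 1"
    by (subst nn_integral_eq_integral) auto
  then show ?thesis
    unfolding * using nn_integral_lborel_prod[of "\<lambda>_ s. ennreal (std_normal_density s)"]
    by (simp add: prod_ennreal)
qed

lemma nn_integral_mvn_density:
  fixes S :: "real ^ 'n ^ 'n"
  assumes S: "sym_pos_def S"
  shows "(\<integral>\<^sup>+x. ennreal (mvn_density \<mu> S x) \<partial>lborel) = 1"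
proof -
  obtain Q :: "real ^ 'n ^ 'n" where Q: "det Q \<noteq> 0" "det S = 1 / (det Q)\<^sup>2" "matrix_inv S = transpose Q ** Q"
    using sym_pos_def_factor[OF S] by metis
  let ?G = "\<lambda>x::real ^ 'n. exp (- (x \<bullet> x) / 2) / sqrt ((2 * pi) ^ CARD('n))"
  have q: "x \<bullet> (matrix_inv S *v x) = (Q *v x) \<bullet> (Q *v x)" for x
  proof -
    have "matrix_inv S *v x = (Q *v x) v* Q"
      by (simp add: Q(3) flip: matrix_vector_mul_assoc)
    then show ?thesis
      by (simp add: dot_lmul_matrix inner_commute[of x])
  qed
  \<comment> \<open>The factor \<open>\<bar>det Q\<bar>\<close> is what
    \<open>1 / sqrt (det S)\<close> becomes; it is exactly the Jacobian of the substitution by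
    \<open>Q\<close>.\<close>
  have d: "mvn_density \<mu> S (\<mu> + x) = \<bar>det Q\<bar> * ?G (Q *v x)" for x
    using Q(1) by (simp add: mvn_density_def q Q(2) real_sqrt_mult real_sqrt_divide field_simps)
  have "(\<integral>\<^sup>+x. ennreal (mvn_density \<mu> S x) \<partial>lborel) = (\<integral>\<^sup>+x. ennreal (mvn_density \<mu> S (\<mu> + x)) \<partial>lborel)"
    by (rule nn_integral_lborel_translate[symmetric]) measurable
  also have "\<dots> = \<bar>det Q\<bar> * (\<integral>\<^sup>+x. ?G (Q *v x) \<partial>lborel)"
    unfolding d by (subst ennreal_mult) (simp_all add: nn_integral_cmult)
  also have "\<dots> = (\<integral>\<^sup>+x. ?G x \<partial>lborel)"
    by (rule nn_integral_lborel_linear[OF Q(1)]) measurable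
  also have "\<dots> = 1" by (rule nn_integral_exp_norm)
  finally show ?thesis .
qed

section \<open>Gaussian distribution functions\<close>

lemma sets_le_vec [measurable]: "{x. \<forall>i. x $ i \<le> c $ i} \<in> sets (borel :: (real ^ 'n) measure)"
  by (intro borel_closed closed_Collect_all closed_Collect_le continuous_intros)

lemma prob_space_mvn: "sym_pos_def S \<Longrightarrow> prob_space (mvn \<mu> S)"
  by (rule prob_spaceI) (simp add: mvn_def emeasure_density nn_integral_mvn_density)

lemma mvn_cdf_nonneg: "mvn_cdf \<mu> S c \<ge> 0"
  by (simp add: mvn_cdf_def)

lemma ennreal_mvn_cdf:
  assumes S: "sym_pos_def S"
  shows "ennreal (mvn_cdf \<mu> S c) =
    (\<integral>\<^sup>+x. ennreal (mvn_density \<mu> S x) * indicator {x. \<forall>i. x $ i \<le> c $ i} x \<partial>lborel)"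
proof -
  interpret prob_space "mvn \<mu> S" using S by (rule prob_space_mvn)
  have "ennreal (mvn_cdf \<mu> S c) = emeasure (mvn \<mu> S) {x. \<forall>i. x $ i \<le> c $ i}"
    by (simp add: mvn_cdf_def emeasure_eq_measure)
  also have "\<dots> = (\<integral>\<^sup>+x. ennreal (mvn_density \<mu> S x) * indicator {x. \<forall>i. x $ i \<le> c $ i} x \<partial>lborel)"
    by (simp add: mvn_def emeasure_density)
  finally show ?thesis .
qed

lemma borel_measurable_mvn_cdf:
  assumes S: "sym_pos_def S"
  shows "mvn_cdf \<mu> S \<in> borel_measurable borel"
proof -
  \<comment> \<open>The indicator of a set varying with \<open>c\<close> is written as a
    conditional, so that the integrand is visibly jointly measurable in \<open>c\<close> and
    \<open>x\<close>.\<close>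
  have "ennreal (mvn_cdf \<mu> S c) =
      (\<integral>\<^sup>+x. ennreal (mvn_density \<mu> S x) * (if \<forall>i. x $ i \<le> c $ i then 1 else 0) \<partial>lborel)" for c
    by (simp add: ennreal_mvn_cdf[OF S] indicator_def of_bool_def)
  then have "mvn_cdf \<mu> S = (\<lambda>c. enn2real
      (\<integral>\<^sup>+x. ennreal (mvn_density \<mu> S x) * (if \<forall>i. x $ i \<le> c $ i then 1 else 0) \<partial>lborel))"
    by (metis enn2real_ennreal mvn_cdf_nonneg)
  also have "\<dots> \<in> borel_measurable borel"
    by measurable
  finally show ?thesis .
qed

section \<open>The covariance \<open>I + A K A\<^sup>T\<close> and Gaussian exponents\<close>

lemma sym_pos_def_mat_1: "sym_pos_def (mat 1)"
  by (simp add: sym_pos_def_def transpose_mat)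

lemma matrix_inv_mat_1: "matrix_inv (mat 1 :: real ^ 'n ^ 'n) = mat 1"
  by (rule matrix_inv_eqI) simp

lemma marginal_covariance_mult_vec:
  fixes A :: "real ^ 'n ^ 'm"
  shows "(mat 1 + A ** K ** transpose A) *v x = x + A *v (K *v (transpose A *v x))"
  by (simp add: matrix_vector_mult_add_rdistrib del: transpose_matrix_vector
      flip: matrix_vector_mul_assoc)

text \<open>The quadratic form is \<open>x \<bullet> x\<close> plus the \<open>K\<close>-form at
  \<open>transpose A *v x\<close>. The second term may vanish for nonzero \<open>x\<close>; strict
  positivity comes from the identity, whatever the rank of \<open>A\<close>.\<close>

lemma sym_pos_def_marginal_covariance:
  fixes A :: "real ^ 'n ^ 'm"
  assumes K: "sym_pos_def K"
  shows "sym_pos_def (mat 1 + A ** K ** transpose A)"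
proof -
  have "transpose (mat 1 + A ** K ** transpose A) = transpose (mat 1) + transpose (A ** K ** transpose A)"
    by (simp add: transpose_def vec_eq_iff)
  also have "\<dots> = mat 1 + A ** K ** transpose A"
    using K by (simp add: sym_pos_def_def matrix_transpose_mul matrix_mul_assoc transpose_mat)
  moreover have "x \<bullet> ((mat 1 + A ** K ** transpose A) *v x) > 0" if "x \<noteq> 0" for x
  proof -
    let ?r = "transpose A *v x"
    have "?r \<bullet> (K *v ?r) \<ge> 0"
      using K by (cases "?r = 0") (auto simp: sym_pos_def_def less_imp_le)
    moreover have "x \<bullet> (A *v (K *v ?r)) = ?r \<bullet> (K *v ?r)"
      by (simp add: dot_lmul_matrix)
    moreover have "x \<bullet> x > 0" using that by simp
    ultimately show ?thesis
      unfolding marginal_covariance_mult_vec inner_add_right by linarith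
  qed
  ultimately show ?thesis by (simp add: sym_pos_def_def)
qed

text \<open>The point \<open>- m\<close> minimises the left-hand side in \<open>z\<close>, with
  minimum \<open>w \<bullet> (matrix_inv S *v w)\<close>. Expressing \<open>m\<close> through
  \<open>matrix_inv S\<close> avoids inverting the precision
  \<open>K\<^sup>-\<^sup>1 + A\<^sup>T A\<close>.\<close>

lemma quadratic_form_complete_square:
  fixes K :: "real ^ 'n ^ 'n" and A :: "real ^ 'n ^ 'm" and w :: "real ^ 'm"
  assumes K: "sym_pos_def K"
  defines "S \<equiv> mat 1 + A ** K ** transpose A"
  defines "m \<equiv> K *v (transpose A *v (matrix_inv S *v w))"
  shows "z \<bullet> (matrix_inv K *v z) + (A *v z + w) \<bullet> (A *v z + w) =
    ((m + z) \<bullet> (matrix_inv K *v (m + z)) + (A *v (m + z)) \<bullet> (A *v (m + z))) + w \<bullet> (matrix_inv S *v w)"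
proof -
  define q where "q = matrix_inv S *v w"
  define r where "r = transpose A *v q"
  have S: "sym_pos_def S" unfolding S_def using K by (rule sym_pos_def_marginal_covariance)
  have m: "m = K *v r" by (simp add: m_def r_def q_def)
  \<comment> \<open>This is the equation \<open>S *v q = w\<close> written out.\<close>
  have w: "w = q + A *v m"
    using sym_pos_def_matrix_inv(2)[OF S, of w]
    unfolding q_def[symmetric] by (simp add: S_def marginal_covariance_mult_vec m r_def del: transpose_matrix_vector)
  have Km: "matrix_inv K *v m = r"
    by (simp add: m sym_pos_def_matrix_inv[OF K])
  have r: "x \<bullet> r = (A *v x) \<bullet> q" for x
    by (simp add: r_def inner_commute[of x] dot_lmul_matrix) (simp add: inner_commute)
  have mz: "m \<bullet> (matrix_inv K *v z) = (A *v z) \<bullet> q"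
    using r[of z] by (simp add: sym_pos_def_matrix_inv_inner[OF K] Km inner_commute)
  show ?thesis
    unfolding q_def[symmetric]
    by (simp add: matrix_vector_right_distrib inner_add_left inner_add_right Km r mz)
       (simp add: w inner_add_left inner_add_right inner_commute)
qed

text \<open>Completing the square in the exponent: the cross term of \<open>z\<close> with
  \<open>K *v t\<close> under \<open>matrix_inv K\<close> is \<open>t \<bullet> z\<close>. Only the
  mean moves, so the normalising denominators agree.\<close>

lemma mvn_density_tilt:
  assumes K: "sym_pos_def K"
  shows "exp (t \<bullet> x) * mvn_density u K x =
    exp (u \<bullet> t + (t \<bullet> (K *v t)) / 2) * mvn_density (u + K *v t) K x"
proof -
  define z where "z = x - u"
  have x: "x = u + z" by (simp add: z_def)
  have "(K *v t) \<bullet> (matrix_inv K *v z) = t \<bullet> z"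
    by (simp add: sym_pos_def_matrix_inv_inner[OF K] sym_pos_def_matrix_inv[OF K])
  moreover have "z - K *v t = x - (u + K *v t)" by (simp add: z_def)
  ultimately have "t \<bullet> x - z \<bullet> (matrix_inv K *v z) / 2 = u \<bullet> t + (t \<bullet> (K *v t)) / 2
     - (x - (u + K *v t)) \<bullet> (matrix_inv K *v (x - (u + K *v t))) / 2"
    by (simp add: x matrix_vector_mult_diff_distrib matrix_vector_right_distrib inner_diff_left
        inner_diff_right inner_add_right inner_add_left sym_pos_def_matrix_inv[OF K])
       (simp add: inner_commute field_simps)
  then show ?thesis
    by (simp add: mvn_density_def z_def[symmetric] mult_exp_exp)
qed

text \<open>
  Up to a factor independent of \<open>w\<close>, completing the square evaluates the inner integral to the
  \<open>N(0, I + A K A\<^sup>T)\<close> density; both sides have total mass 1 in \<open>w\<close>, so that factor is 1.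
\<close>

lemma nn_integral_mvn_density_convolution:
  fixes K :: "real ^ 'n ^ 'n" and A :: "real ^ 'n ^ 'm"
  assumes K: "sym_pos_def K"
  shows "(\<integral>\<^sup>+z. ennreal (mvn_density 0 K z) * ennreal (mvn_density 0 (mat 1) (A *v z + w)) \<partial>lborel) =
    ennreal (mvn_density 0 (mat 1 + A ** K ** transpose A) w)"
proof -
  let ?S = "mat 1 + A ** K ** transpose A"
  have S: "sym_pos_def ?S" using K by (rule sym_pos_def_marginal_covariance)
  define h where "h w = (\<integral>\<^sup>+z. ennreal (mvn_density 0 K z) * ennreal (mvn_density 0 (mat 1) (A *v z + w)) \<partial>lborel)" for w
  define E where "E z = exp (- (z \<bullet> (matrix_inv K *v z) + (A *v z) \<bullet> (A *v z)) / 2)" for z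
  have [measurable]: "E \<in> borel_measurable borel" unfolding E_def by measurable
  \<comment> \<open>\<open>k\<close> collects the three normalising denominators. Only its sign is
    used: the constant \<open>C\<close> is found by comparing total masses, so no determinant
    identity has to be proved.\<close>
  define k where "k = sqrt ((2 * pi) ^ CARD('m) * det ?S)
    / (sqrt ((2 * pi) ^ CARD('n) * det K) * sqrt ((2 * pi) ^ CARD('m)))"
  have k: "k \<ge> 0"
    using sym_pos_def_det_pos[OF K] sym_pos_def_det_pos[OF S] by (simp add: k_def)
  define C where "C = ennreal k * (\<integral>\<^sup>+z. E z \<partial>lborel)"
  have h: "h w = C * ennreal (mvn_density 0 ?S w)" for w
  proof -
    let ?m = "K *v (transpose A *v (matrix_inv ?S *v w))"
    have "mvn_density 0 K z * mvn_density 0 (mat 1) (A *v z + w) = k * mvn_density 0 ?S w * E (?m + z)" for z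
    proof -
      have "exp (- (z \<bullet> (matrix_inv K *v z)) / 2) * exp (- ((A *v z + w) \<bullet> (A *v z + w)) / 2) =
        E (?m + z) * exp (- (w \<bullet> (matrix_inv ?S *v w)) / 2)"
        using quadratic_form_complete_square[OF K, of z A w]
        unfolding E_def mult_exp_exp by (simp add: field_simps del: transpose_matrix_vector)
      then show ?thesis
        using sym_pos_def_det_pos[OF S]
        by (simp add: mvn_density_def k_def matrix_inv_mat_1 del: transpose_matrix_vector)
    qed
    then have "h w = (\<integral>\<^sup>+z. ennreal (k * mvn_density 0 ?S w) * ennreal (E (?m + z)) \<partial>lborel)"
      using k unfolding h_def
      by (simp add: mvn_density_nonneg K S sym_pos_def_mat_1 E_def flip: ennreal_mult del: transpose_matrix_vector)
    also have "\<dots> = ennreal (k * mvn_density 0 ?S w) * (\<integral>\<^sup>+z. ennreal (E z) \<partial>lborel)"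
      by (subst nn_integral_cmult, measurable)
         (subst nn_integral_lborel_translate[of "\<lambda>z. ennreal (E z)"], auto)
    finally show ?thesis
      using k by (simp add: C_def ennreal_mult mvn_density_nonneg S ac_simps)
  qed
  have "C = (\<integral>\<^sup>+w. h w \<partial>lborel)"
    by (simp add: h nn_integral_cmult nn_integral_mvn_density[OF S])
  also have "\<dots> = (\<integral>\<^sup>+z. \<integral>\<^sup>+w. ennreal (mvn_density 0 K z) * ennreal (mvn_density 0 (mat 1) (A *v z + w)) \<partial>lborel \<partial>lborel)"
    unfolding h_def by (rule lborel_pair.Fubini') measurable
  also have "\<dots> = (\<integral>\<^sup>+z. ennreal (mvn_density 0 K z) \<partial>lborel)"
    by (intro nn_integral_cong, subst nn_integral_cmult, measurable,
        subst nn_integral_lborel_translate[of "\<lambda>w. ennreal (mvn_density 0 (mat 1) w)"])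
       (simp_all add: nn_integral_mvn_density sym_pos_def_mat_1)
  also have "\<dots> = 1" using K by (rule nn_integral_mvn_density)
  finally show ?thesis using h[of w] by (simp add: h_def)
qed

text \<open>The mean \<open>u\<close> is arbitrary because the result is used both at the original
  mean and at the tilted mean \<open>u + K *v t\<close>.\<close>

lemma nn_integral_mvn_density_mvn_cdf:
  fixes K :: "real ^ 'n ^ 'n" and A :: "real ^ 'n ^ 'm"
  assumes K: "sym_pos_def K"
  shows "(\<integral>\<^sup>+x. ennreal (mvn_density u K x * mvn_cdf 0 (mat 1) (A *v x + b)) \<partial>lborel) =
    ennreal (mvn_cdf 0 (mat 1 + A ** K ** transpose A) (A *v u + b))"
proof -
  let ?S = "mat 1 + A ** K ** transpose A" and ?c = "A *v u + b"
  let ?I = "indicator {w. \<forall>i. w $ i \<le> ?c $ i} :: real ^ 'm \<Rightarrow> ennreal"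
  let ?g = "\<lambda>y::real ^ 'm. ennreal (mvn_density 0 (mat 1) y)"
  have shift: "mvn_density u K (u + z) = mvn_density 0 K z" for z
    by (simp add: mvn_density_def)
  have cdf: "ennreal (mvn_cdf 0 (mat 1) (A *v (u + z) + b)) = (\<integral>\<^sup>+w. ?g (A *v z + w) * ?I w \<partial>lborel)" for z
  proof -
    let ?J = "indicator {y. \<forall>i. y $ i \<le> (A *v (u + z) + b) $ i} :: real ^ 'm \<Rightarrow> ennreal"
    \<comment> \<open>After the shift the region no longer depends on \<open>z\<close>, so its
      indicator can leave the \<open>z\<close>-integral once the order of integration is
      swapped.\<close>
    have "?J (A *v z + w) = ?I w" for w
      by (auto simp: indicator_def matrix_vector_right_distrib algebra_simps)
    then show ?thesis
      using nn_integral_lborel_translate[of "\<lambda>y. ?g y * ?J y" "A *v z"]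
      by (simp add: ennreal_mvn_cdf sym_pos_def_mat_1)
  qed
  note [measurable] = borel_measurable_mvn_cdf[OF sym_pos_def_mat_1]
  have "(\<integral>\<^sup>+x. ennreal (mvn_density u K x * mvn_cdf 0 (mat 1) (A *v x + b)) \<partial>lborel)
    = (\<integral>\<^sup>+x. ennreal (mvn_density u K x) * ennreal (mvn_cdf 0 (mat 1) (A *v x + b)) \<partial>lborel)"
    by (simp add: ennreal_mult mvn_density_nonneg K mvn_cdf_nonneg)
  also have "\<dots> = (\<integral>\<^sup>+z. ennreal (mvn_density u K (u + z)) * ennreal (mvn_cdf 0 (mat 1) (A *v (u + z) + b)) \<partial>lborel)"
    by (rule nn_integral_lborel_translate[symmetric]) measurable
  also have "\<dots> = (\<integral>\<^sup>+z. \<integral>\<^sup>+w. ennreal (mvn_density 0 K z) * ?g (A *v z + w) * ?I w \<partial>lborel \<partial>lborel)"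
    unfolding shift cdf by (simp add: nn_integral_cmult mult.assoc)
  also have "\<dots> = (\<integral>\<^sup>+w. \<integral>\<^sup>+z. ennreal (mvn_density 0 K z) * ?g (A *v z + w) * ?I w \<partial>lborel \<partial>lborel)"
    by (rule lborel_pair.Fubini') measurable
  also have "\<dots> = (\<integral>\<^sup>+w. ennreal (mvn_density 0 ?S w) * ?I w \<partial>lborel)"
    by (simp add: nn_integral_multc nn_integral_mvn_density_convolution[OF K] del: transpose_matrix_vector)
  also have "\<dots> = ennreal (mvn_cdf 0 ?S ?c)"
    using sym_pos_def_marginal_covariance[OF K] by (rule ennreal_mvn_cdf[symmetric])
  finally show ?thesis .
qed

section \<open>Density and moment generating function of the constrained vector\<close>

theorem mainTheorem2:
  fixes M :: "'a measure" and g :: "'a \<Rightarrow> real ^ 'n"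
    and u :: "real ^ 'n" and K :: "real ^ 'n ^ 'n"
    and A :: "real ^ 'n ^ 'm" and b :: "real ^ 'm"
  assumes "prob_space M"
    and "sym_pos_def K"
    and "cgp_vector M g u K A b"
  shows "distributed M lborel g
           (\<lambda>x. ennreal (mvn_density u K x * mvn_cdf 0 (mat 1) (A *v x + b)
                  / mvn_cdf 0 (mat 1 + A ** K ** transpose A) (A *v u + b)))
       \<and> (\<forall>t. integrable M (\<lambda>\<omega>. exp (t \<bullet> g \<omega>))
            \<and> mgf M g t =
                exp (u \<bullet> t + (t \<bullet> (K *v t)) / 2)
                * (mvn_cdf 0 (mat 1 + A ** K ** transpose A) (A *v u + b + (A ** K) *v t)
                   / mvn_cdf 0 (mat 1 + A ** K ** transpose A) (A *v u + b)))"
proof -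
  interpret prob_space M by fact
  note K = assms(2)
  let ?Z = "mvn_cdf 0 (mat 1 + A ** K ** transpose A)"
  let ?F = "\<lambda>v x. mvn_density v K x * mvn_cdf 0 (mat 1) (A *v x + b)"
  have F0: "?F v x \<ge> 0" for v x
    by (simp add: mvn_density_nonneg K mvn_cdf_nonneg)
  obtain c where "c > 0" and D: "distributed M lborel g (\<lambda>x. ennreal (c * ?F u x))"
    using assms(3) by (auto simp: cgp_vector_def)
  note [measurable] = borel_measurable_mvn_cdf[OF sym_pos_def_mat_1]
  \<comment> \<open>One computation for two uses: \<open>e = 1\<close>, \<open>k = 1\<close>,
    \<open>v = u\<close> gives the normalisation, and the exponential weight with
    \<open>v = u + K *v t\<close> gives the moment generating function.\<close>
  have scaled: "(\<integral>\<^sup>+\<omega>. ennreal (e (g \<omega>)) \<partial>M) = ennreal (c * k * ?Z (A *v v + b))"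
    if "\<And>x. e x \<ge> 0" "k \<ge> 0" and tilt: "\<And>x. e x * mvn_density u K x = k * mvn_density v K x"
      and [measurable]: "e \<in> borel_measurable borel" for e k v
  proof -
    have "ennreal (c * ?F u x) * ennreal (e x) = ennreal (c * k) * ennreal (?F v x)" for x
    proof -
      have "c * ?F u x * e x = c * k * ?F v x"
        using tilt[of x] by (simp add: algebra_simps)
      then show ?thesis
        using that(1,2) \<open>c > 0\<close> F0 by (simp flip: ennreal_mult)
    qed
    then have "(\<integral>\<^sup>+\<omega>. ennreal (e (g \<omega>)) \<partial>M) = ennreal (c * k) * (\<integral>\<^sup>+x. ennreal (?F v x) \<partial>lborel)"
      using distributed_nn_integral[OF D, of "\<lambda>x. ennreal (e x)"] by (simp add: nn_integral_cmult)
    then show ?thesis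
      using that(2) \<open>c > 0\<close> by (simp add: nn_integral_mvn_density_mvn_cdf[OF K] ennreal_mult mvn_cdf_nonneg)
  qed
  have "ennreal (c * ?Z (A *v u + b)) = 1"
    using scaled[of "\<lambda>_. 1" 1 u] by (simp add: emeasure_space_1)
  \<comment> \<open>This also shows that the denominator is nonzero, so the quotients in the
    conclusion are genuine.\<close>
  then have "c * ?Z (A *v u + b) = 1"
    by (simp add: ennreal_eq_1)
  then have c: "c = 1 / ?Z (A *v u + b)"
    by (metis mult_zero_right nonzero_eq_divide_eq zero_neq_one)
  have "integrable M (\<lambda>\<omega>. exp (t \<bullet> g \<omega>)) \<and> mgf M g t = exp (u \<bullet> t + (t \<bullet> (K *v t)) / 2)
      * (?Z (A *v u + b + (A ** K) *v t) / ?Z (A *v u + b))" for t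
  proof -
    let ?k = "exp (u \<bullet> t + (t \<bullet> (K *v t)) / 2)"
    have [measurable]: "g \<in> borel_measurable M"
      using distributed_measurable[OF D] by simp
    have shift: "A *v (u + K *v t) + b = A *v u + b + (A ** K) *v t"
      by (simp add: matrix_vector_right_distrib matrix_vector_mul_assoc algebra_simps)
    have "(\<integral>\<^sup>+\<omega>. ennreal (exp (t \<bullet> g \<omega>)) \<partial>M) = ennreal (c * ?k * ?Z (A *v u + b + (A ** K) *v t))"
      unfolding shift[symmetric] by (rule scaled[OF _ _ mvn_density_tilt[OF K]]) simp_all
    \<comment> \<open>A nonnegative measurable function whose nonnegative integral is a real number
      is integrable with that value, so finiteness and the formula come together.\<close>
    then have "integrable M (\<lambda>\<omega>. exp (t \<bullet> g \<omega>))
        \<and> integral\<^sup>L M (\<lambda>\<omega>. exp (t \<bullet> g \<omega>)) = c * ?k * ?Z (A *v u + b + (A ** K) *v t)"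
      using \<open>c > 0\<close> by (subst (asm) nn_integral_eq_integrable) (auto simp: mvn_cdf_nonneg)
    then show ?thesis
      by (simp add: mgf_def c)
  qed
  with D show ?thesis
    by (simp add: c)
qed

end
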